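(* Let $\|\cdot\|$ be a norm on $\mathbb{R}^d$, with associated Capra coupling ¢. Let $f:\mathbb{R}^d\to\overline{\mathbb{R}}=[-\infty,+\infty]$ be any function. For all $x\in\mathbb{R}^d$, the Capra-subdifferential $\partial_{¢}f(x)$ is a closed convex set.
   Context: $\mathbb{R}^d$ ($d\ge 1$) is equipped with the scalar product $\langle\cdot,\cdot\rangle$ (the source norm $\|\cdot\|$ need not be Euclidean). The Capra (constant along primal rays) coupling ¢ $:\mathbb{R}^d\times\mathbb{R}^d\to\mathbb{R}$ associated with $\|\cdot\|$ is ¢$(x,y)=\langle x,y\rangle/\|x\|$ if $x\neq 0$, and ¢$(0,y)=0$. The Moreau lower addition $\dot{+}$ on $\overline{\mathbb{R}}$ extends the usual addition with $(+\infty)\dot{+}(-\infty)=(-\infty)\dot{+}(+\infty)=-\infty$. The ¢-conjugate of $f:\mathbb{R}^d\to\overline{\mathbb{R}}$ is $f^{¢}(y)=\sup_{x\in\mathbb{R}^d}\big(¢(x,y)\dot{+}(-f(x))\big)$ for $y\in\mathbb{R}^d$. The Capra-subdifferential of $f$ at $x$ is $\partial_{¢}f(x)=\{y\in\mathbb{R}^d : f^{¢}(y)=¢(x,y)\dot{+}(-f(x))\}$. *)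

theory Defs
  imports "HOL-Analysis.Analysis"
begin

(* The source norm N is an arbitrary norm, unrelated to the library's Euclidean norm. *)
definition is_norm :: "('a::real_vector \<Rightarrow> real) \<Rightarrow> bool" where
  "is_norm N \<longleftrightarrow>
     (\<forall>x. 0 \<le> N x) \<and>
     (\<forall>x. N x = 0 \<longleftrightarrow> x = 0) \<and>
     (\<forall>c x. N (c *\<^sub>R x) = \<bar>c\<bar> * N x) \<and>
     (\<forall>x y. N (x + y) \<le> N x + N y)"

(* Moreau lower addition: on ereal, (+) gives \<infinity> + (-\<infinity>) = \<infinity>, whereas here
   -\<infinity> is absorbing. *)
definition lower_add :: "ereal \<Rightarrow> ereal \<Rightarrow> ereal" (infixl \<open>+\<^sub>l\<close> 65) where
  "a +\<^sub>l b = (if a = -\<infinity> \<or> b = -\<infinity> then -\<infinity> else a + b)"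

definition capra_coupling :: "(real^'d \<Rightarrow> real) \<Rightarrow> real^'d \<Rightarrow> real^'d \<Rightarrow> real" where
  "capra_coupling N x y = (if x = 0 then 0 else (x \<bullet> y) / N x)"

definition capra_conjugate ::
  "(real^'d \<Rightarrow> real) \<Rightarrow> (real^'d \<Rightarrow> ereal) \<Rightarrow> real^'d \<Rightarrow> ereal" where
  "capra_conjugate N f y = (SUP x. ereal (capra_coupling N x y) +\<^sub>l (- f x))"

definition capra_subdifferential ::
  "(real^'d \<Rightarrow> real) \<Rightarrow> (real^'d \<Rightarrow> ereal) \<Rightarrow> real^'d \<Rightarrow> (real^'d) set" where
  "capra_subdifferential N f x =
     {y. capra_conjugate N f y = ereal (capra_coupling N x y) +\<^sub>l (- f x)}"

end

theory Submission
  imports Defs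
begin

text \<open>
  For a fixed first argument the coupling is linear in \<open>y\<close>: it is the scalar product of \<open>y\<close>
  with the normalisation of that argument. By definition of the conjugate as a supremum, \<open>y\<close> is a
  Capra-subgradient of \<open>f\<close> at \<open>x\<close> iff \<open>x\<close> attains the supremum, that is, iff for
  every \<open>z\<close> the expression at \<open>z\<close> is at most the one at \<open>x\<close>. For one \<open>z\<close>
  this compares two affine functions of \<open>y\<close>: if \<open>f x\<close> and \<open>f z\<close> are finite it
  cuts out a closed half-space (or, when the slopes agree, everything or nothing), and if one of them
  is infinite the truth of the comparison does not depend on \<open>y\<close>
  (\<open>lower_add_affine_le_cases\<close>). So the subdifferential is an intersection of closed convex sets.
\<close>

lemma capra_coupling_eq_inner:
  "capra_coupling N z y = ((1 / N z) *\<^sub>R z) \<bullet> y"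
  by (simp add: capra_coupling_def)

lemma capra_subdifferential_eq_Inter:
  "capra_subdifferential N f x =
     (\<Inter>z. {y. ereal (capra_coupling N z y) +\<^sub>l (- f z) \<le> ereal (capra_coupling N x y) +\<^sub>l (- f x)})"
proof -
  have attained: "(SUP z. h z) = h x \<longleftrightarrow> (\<forall>z. h z \<le> h x)" for h :: "_ \<Rightarrow> ereal"
    by (metis SUP_least SUP_upper UNIV_I order_antisym)
  show ?thesis
    unfolding capra_subdifferential_def capra_conjugate_def
    using attained[of "\<lambda>z. ereal (capra_coupling N z y) +\<^sub>l (- f z)" for y] by simp blast
qed

text \<open>
  With lower addition an infinite constant swallows the finite linear term, so a comparison that
  involves one is decided by the constants alone and its solution set is trivial.
\<close>
lemma lower_add_affine_le_cases:
  fixes a b :: "'a::real_inner" and \<alpha> \<beta> :: ereal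
  defines "S \<equiv> {y. ereal (a \<bullet> y) +\<^sub>l \<alpha> \<le> ereal (b \<bullet> y) +\<^sub>l \<beta>}"
  obtains "S = {}" | "S = UNIV" | c where "S = {y. (a - b) \<bullet> y \<le> c}"
proof (cases "\<bar>\<alpha>\<bar> = \<infinity> \<or> \<bar>\<beta>\<bar> = \<infinity>")
  case True
  then have "S = {} \<or> S = UNIV"
    unfolding S_def lower_add_def by (cases \<alpha>; cases \<beta>) auto
  then show thesis
    using that by blast
next
  case False
  then obtain r s where "\<alpha> = ereal r" "\<beta> = ereal s"
    by (cases \<alpha>; cases \<beta>) auto
  then have "S = {y. (a - b) \<bullet> y \<le> s - r}"
    unfolding S_def lower_add_def by (auto simp: inner_diff_left)
  then show thesis
    by (rule that)
qed

lemma closed_convex_lower_add_affine_le: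
  fixes a b :: "'a::real_inner" and \<alpha> \<beta> :: ereal
  shows "closed {y. ereal (a \<bullet> y) +\<^sub>l \<alpha> \<le> ereal (b \<bullet> y) +\<^sub>l \<beta>}"
    and "convex {y. ereal (a \<bullet> y) +\<^sub>l \<alpha> \<le> ereal (b \<bullet> y) +\<^sub>l \<beta>}"
  by (rule lower_add_affine_le_cases[of a \<alpha> b \<beta>];
      simp only: closed_empty closed_UNIV closed_halfspace_le
        convex_empty convex_UNIV convex_halfspace_le)+

theorem proposition6:
  fixes N :: "real^'d \<Rightarrow> real"
    and f :: "real^'d \<Rightarrow> ereal"
    and x :: "real^'d"
  assumes "is_norm N"
  shows "closed (capra_subdifferential N f x) \<and> convex (capra_subdifferential N f x)"
  unfolding capra_subdifferential_eq_Inter capra_coupling_eq_inner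
  by (intro conjI closed_INT convex_INT ballI closed_convex_lower_add_affine_le)

end
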